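(* Let $\mathcal{M}_1$ be a general rotational surface of elliptic type in $\mathbb{E}^4_2$ with plane meridian curve $m$, i.e. the Lorentz surface $$z(u,v)=\left(f(u)\cos\alpha v,\ f(u)\sin\alpha v,\ g(u)\cos\beta v,\ g(u)\sin\beta v\right),\quad u\in J,\ v\in[0,2\pi),$$ where $\alpha,\beta$ are positive constants and $f,g$ are smooth functions on $J$ with $\alpha^2f^2-\beta^2g^2<0$ and $f'^2-g'^2>0$. Then $\mathcal{M}_1$ has parallel normalized mean curvature vector field if and only if, up to a change of the parameter $u$ (the meridian curve $m$ being regarded as the plane curve traced by the points $(f,g)$), $m$ is determined by $$f(u)=\pm\sqrt{u^2-C^2},\qquad g(u)=u,\qquad C=const\neq0.$$
   Context: $\mathbb{E}^4_2$ is $\mathbb{R}^4$ with the metric $dx_1^2+dx_2^2-dx_3^2-dx_4^2$. $J\subset\mathbb{R}$ is an interval. The meridian curve $m$ is the plane curve $u\mapsto(f(u),0,g(u),0)$. A surface in $\mathbb{E}^4_2$ is Lorentz if its induced metric has signature $(1,1)$; here the first fundamental form is $E=f'^2-g'^2>0$, $F=0$, $G=\alpha^2f^2-\beta^2g^2<0$. With $\sigma$ the second fundamental form and $D$ the normal connection, the mean curvature vector field is $H=\frac12\operatorname{tr}\sigma$. A normal vector field $\xi$ is parallel if $D\xi=0$ identically. The surface has parallel normalized mean curvature vector field if $H$ is non-zero and there exists a unit vector field in the direction of $H$ (that is, $\langle\xi,\xi\rangle=\pm1$) which is parallel in the normal bundle. *)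

theory Defs
  imports "HOL-Analysis.Analysis"
begin

definition metric42 :: "real^4 \<Rightarrow> real^4 \<Rightarrow> real" where
  "metric42 x y = x$1 * y$1 + x$2 * y$2 - x$3 * y$3 - x$4 * y$4"

text \<open>
  Parameter domains are products \<open>J \<times> V\<close> of nondegenerate, not necessarily open intervals.
  All derivatives are taken within the parameter intervals, hence are one-sided at end points
  that belong to them, and nothing depends on values outside the domain.
\<close>

definition smooth_on_interval :: "real set \<Rightarrow> (real \<Rightarrow> real) \<Rightarrow> bool" where
  "smooth_on_interval J f \<longleftrightarrow>
     (\<exists>F :: nat \<Rightarrow> real \<Rightarrow> real. (\<forall>u\<in>J. F 0 u = f u) \<and>
        (\<forall>n. \<forall>u\<in>J. (F n has_real_derivative F (Suc n) u) (at u within J)))"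

definition du :: "real set \<Rightarrow> (real \<Rightarrow> real \<Rightarrow> real^4) \<Rightarrow> real \<Rightarrow> real \<Rightarrow> real^4" where
  "du J w u v = vector_derivative (\<lambda>s. w s v) (at u within J)"

definition dv :: "real set \<Rightarrow> (real \<Rightarrow> real \<Rightarrow> real^4) \<Rightarrow> real \<Rightarrow> real \<Rightarrow> real^4" where
  "dv V w u v = vector_derivative (\<lambda>t. w u t) (at v within V)"

text \<open>
  In the next definition \<open>F i j\<close> is the mixed partial derivative of order \<open>i\<close> in \<open>u\<close> and
  \<open>j\<close> in \<open>v\<close>.
\<close>

definition smooth_field :: "real set \<Rightarrow> real set \<Rightarrow> (real \<Rightarrow> real \<Rightarrow> real^4) \<Rightarrow> bool" where
  "smooth_field J V w \<longleftrightarrow>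
     (\<exists>F :: nat \<Rightarrow> nat \<Rightarrow> real \<Rightarrow> real \<Rightarrow> real^4.
        (\<forall>u\<in>J. \<forall>v\<in>V. F 0 0 u v = w u v) \<and>
        (\<forall>i j. continuous_on (J \<times> V) (\<lambda>(u, v). F i j u v) \<and>
           (\<forall>u\<in>J. \<forall>v\<in>V.
              ((\<lambda>s. F i j s v) has_vector_derivative F (Suc i) j u v) (at u within J) \<and>
              ((\<lambda>t. F i j u t) has_vector_derivative F i (Suc j) u v) (at v within V))))"

definition ffE :: "real set \<Rightarrow> (real \<Rightarrow> real \<Rightarrow> real^4) \<Rightarrow> real \<Rightarrow> real \<Rightarrow> real" where
  "ffE J z u v = metric42 (du J z u v) (du J z u v)"

definition ffF :: "real set \<Rightarrow> real set \<Rightarrow> (real \<Rightarrow> real \<Rightarrow> real^4) \<Rightarrow> real \<Rightarrow> real \<Rightarrow> real" where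
  "ffF J V z u v = metric42 (du J z u v) (dv V z u v)"

definition ffG :: "real set \<Rightarrow> (real \<Rightarrow> real \<Rightarrow> real^4) \<Rightarrow> real \<Rightarrow> real \<Rightarrow> real" where
  "ffG V z u v = metric42 (dv V z u v) (dv V z u v)"

definition is_normal ::
  "real set \<Rightarrow> real set \<Rightarrow> (real \<Rightarrow> real \<Rightarrow> real^4) \<Rightarrow> real \<Rightarrow> real \<Rightarrow> real^4 \<Rightarrow> bool" where
  "is_normal J V z u v n \<longleftrightarrow> metric42 n (du J z u v) = 0 \<and> metric42 n (dv V z u v) = 0"

text \<open>
  The normal part is well defined where \<open>E G - F\<^sup>2 \<noteq> 0\<close>, in particular on a Lorentz surface.
\<close>

definition normal_part ::
  "real set \<Rightarrow> real set \<Rightarrow> (real \<Rightarrow> real \<Rightarrow> real^4) \<Rightarrow> real \<Rightarrow> real \<Rightarrow> real^4 \<Rightarrow> real^4" where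
  "normal_part J V z u v w =
     (THE n. is_normal J V z u v n \<and> w - n \<in> span {du J z u v, dv V z u v})"

text \<open>
  By the Gauss formula, the second fundamental form on coordinate fields is the normal part of
  the second partial derivatives of \<open>z\<close>.
\<close>

definition sigma_uu ::
  "real set \<Rightarrow> real set \<Rightarrow> (real \<Rightarrow> real \<Rightarrow> real^4) \<Rightarrow> real \<Rightarrow> real \<Rightarrow> real^4" where
  "sigma_uu J V z u v = normal_part J V z u v (du J (du J z) u v)"

definition sigma_uv ::
  "real set \<Rightarrow> real set \<Rightarrow> (real \<Rightarrow> real \<Rightarrow> real^4) \<Rightarrow> real \<Rightarrow> real \<Rightarrow> real^4" where
  "sigma_uv J V z u v = normal_part J V z u v (du J (dv V z) u v)"

definition sigma_vv ::
  "real set \<Rightarrow> real set \<Rightarrow> (real \<Rightarrow> real \<Rightarrow> real^4) \<Rightarrow> real \<Rightarrow> real \<Rightarrow> real^4" where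
  "sigma_vv J V z u v = normal_part J V z u v (dv V (dv V z) u v)"

text \<open>
  \<open>H = 1/2 tr \<sigma>\<close>, the trace being taken with respect to the induced metric, i.e. by contracting
  with the inverse of its Gram matrix.
\<close>

definition mean_curv ::
  "real set \<Rightarrow> real set \<Rightarrow> (real \<Rightarrow> real \<Rightarrow> real^4) \<Rightarrow> real \<Rightarrow> real \<Rightarrow> real^4" where
  "mean_curv J V z u v =
     (1/2) *\<^sub>R ((1 / (ffE J z u v * ffG V z u v - (ffF J V z u v)\<^sup>2)) *\<^sub>R
        (ffG V z u v *\<^sub>R sigma_uu J V z u v
         - (2 * ffF J V z u v) *\<^sub>R sigma_uv J V z u v
         + ffE J z u v *\<^sub>R sigma_vv J V z u v))"

definition normal_field ::
  "real set \<Rightarrow> real set \<Rightarrow> (real \<Rightarrow> real \<Rightarrow> real^4) \<Rightarrow> (real \<Rightarrow> real \<Rightarrow> real^4) \<Rightarrow> bool" where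
  "normal_field J V z \<xi> \<longleftrightarrow>
     smooth_field J V \<xi> \<and> (\<forall>u\<in>J. \<forall>v\<in>V. is_normal J V z u v (\<xi> u v))"

text \<open>
  \<open>D\<^sub>X \<xi>\<close> is the normal part of the flat derivative of \<open>\<xi>\<close> along \<open>X\<close>; it is tensorial in \<open>X\<close>,
  so that \<open>D \<xi> = 0\<close> may be tested on the coordinate fields.
\<close>

definition parallel_normal ::
  "real set \<Rightarrow> real set \<Rightarrow> (real \<Rightarrow> real \<Rightarrow> real^4) \<Rightarrow> (real \<Rightarrow> real \<Rightarrow> real^4) \<Rightarrow> bool" where
  "parallel_normal J V z \<xi> \<longleftrightarrow> normal_field J V z \<xi> \<and>
     (\<forall>u\<in>J. \<forall>v\<in>V. normal_part J V z u v (du J \<xi> u v) = 0 \<and>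
                   normal_part J V z u v (dv V \<xi> u v) = 0)"

definition has_parallel_normalized_mean_curv ::
  "real set \<Rightarrow> real set \<Rightarrow> (real \<Rightarrow> real \<Rightarrow> real^4) \<Rightarrow> bool" where
  "has_parallel_normalized_mean_curv J V z \<longleftrightarrow>
     (\<forall>u\<in>J. \<forall>v\<in>V. mean_curv J V z u v \<noteq> 0) \<and>
     (\<exists>\<xi>. parallel_normal J V z \<xi> \<and>
        (\<forall>u\<in>J. \<forall>v\<in>V. metric42 (\<xi> u v) (\<xi> u v) \<in> {1, -1} \<and>
                      (\<exists>c>0. mean_curv J V z u v = c *\<^sub>R \<xi> u v)))"

definition general_rotational_elliptic ::
  "real \<Rightarrow> real \<Rightarrow> (real \<Rightarrow> real) \<Rightarrow> (real \<Rightarrow> real) \<Rightarrow> real \<Rightarrow> real \<Rightarrow> real^4" where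
  "general_rotational_elliptic \<alpha> \<beta> f g u v =
     vector [f u * cos (\<alpha> * v), f u * sin (\<alpha> * v), g u * cos (\<beta> * v), g u * sin (\<beta> * v)]"

text \<open>
  The meridian is \<open>(\<plusminus>sqrt (p\<^sup>2 - C\<^sup>2), p)\<close> in terms of a new parameter \<open>p = \<phi> u\<close>. The sign is
  allowed to depend on the point: since the meridian is regarded as the plane curve traced by
  \<open>(f, g)\<close>, it may pass through a vertex \<open>(0, \<plusminus>C)\<close> of the hyperbola \<open>g\<^sup>2 - f\<^sup>2 = C\<^sup>2\<close>, where the
  sign changes and where \<open>p\<close> fails to be a regular parameter; away from the vertices \<open>p\<close> is
  required to be one. (By continuity the sign is constant on each interval on which \<open>f \<noteq> 0\<close>.)
\<close>

definition meridian_hyperbola ::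
  "real set \<Rightarrow> (real \<Rightarrow> real) \<Rightarrow> (real \<Rightarrow> real) \<Rightarrow> real \<Rightarrow> bool" where
  "meridian_hyperbola J f g C \<longleftrightarrow>
     (\<exists>\<phi>. smooth_on_interval J \<phi> \<and>
        (\<forall>u\<in>J. f u \<noteq> 0 \<longrightarrow> vector_derivative \<phi> (at u within J) \<noteq> 0) \<and>
        (\<forall>u\<in>J. C\<^sup>2 \<le> (\<phi> u)\<^sup>2 \<and>
           (f u = sqrt ((\<phi> u)\<^sup>2 - C\<^sup>2) \<or> f u = - sqrt ((\<phi> u)\<^sup>2 - C\<^sup>2)) \<and> g u = \<phi> u))"

end

theory Submission
  imports Defs
begin

text \<open>
  Write a vector at the parameter value \<open>v\<close> by its coordinates \<open>(a, b, c, d)\<close> in the frame that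
  turns with speed \<open>\<alpha>\<close> in the first coordinate plane and with speed \<open>\<beta>\<close> in the second one. The
  metric keeps the form \<open>a\<^sup>2 + b\<^sup>2 - c\<^sup>2 - d\<^sup>2\<close>, the surface is \<open>z = (f, 0, g, 0)\<close>, its tangent
  vectors are \<open>(f', 0, g', 0)\<close> and \<open>(0, \<alpha> f, 0, \<beta> g)\<close>, and
  \<open>n1 = (g', 0, f', 0)\<close>, \<open>n2 = (0, \<beta> g, 0, \<alpha> f)\<close> is an orthogonal frame of the normal bundle.
  The second derivatives \<open>z_uu\<close> and \<open>z_vv\<close> have the shape \<open>(*, 0, *, 0)\<close>, so they are orthogonal
  to \<open>n2\<close>; as the tangent vectors are orthogonal to each other, the mean curvature vector \<open>H\<close> is a
  multiple of \<open>n1\<close> (\<open>mean_curv_z\<close>).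

  Suppose that a unit field \<open>\<xi>\<close> along \<open>H\<close> is parallel. It is then a nonzero multiple of \<open>n1\<close>, so
  \<open>\<langle>\<xi>, n2\<rangle> = 0\<close>. Differentiating this along the rotation and using that \<open>\<xi>_v\<close> is tangent gives
  \<open>\<langle>\<xi>, (n2)_v\<rangle> = 0\<close>, which amounts to \<open>f f' = g g'\<close>
  (\<open>parallel_normalized_imp_position_normal\<close>). Hence \<open>g\<^sup>2 - f\<^sup>2\<close> is a constant \<open>K\<close>.
  Since \<open>f'\<^sup>2 > g'\<^sup>2\<close>, the equation \<open>f\<^sup>2 f'\<^sup>2 = g\<^sup>2 g'\<^sup>2\<close> with \<open>g \<noteq> 0\<close> forces \<open>f\<^sup>2 < g\<^sup>2\<close>, so \<open>K\<close> is
  positive and the meridian lies on a hyperbola, with \<open>g\<close> itself as the parameter.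

  Conversely, let \<open>g\<^sup>2 - f\<^sup>2 = C\<^sup>2\<close>. The surface lies in the hyperquadric \<open>\<langle>x, x\<rangle> = -C\<^sup>2\<close>, whose
  normal at a point is its position vector, and the surface is minimal in it: \<open>H = z / C\<^sup>2\<close>. The
  unit field is therefore \<open>z / C\<close>. Its derivatives are tangent, so it is parallel
  (\<open>hyperbola_imp_parallel_normalized\<close>).
\<close>

section \<open>The rotating frame\<close>

lemma vector_4:
  "(vector [a, b, c, d] :: 'a::zero^4) $ 1 = a" "(vector [a, b, c, d] :: 'a^4) $ 2 = b"
  "(vector [a, b, c, d] :: 'a^4) $ 3 = c" "(vector [a, b, c, d] :: 'a^4) $ 4 = d"
  by (simp_all add: vector_def)

lemma vector_4_eq_axis_sum:
  "(vector [a, b, c, d] :: real^4) =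
     a *\<^sub>R axis 1 1 + b *\<^sub>R axis 2 1 + c *\<^sub>R axis 3 1 + d *\<^sub>R axis 4 1"
  by (simp add: vec_eq_iff forall_4 axis_def vector_4)

text \<open>
  In coordinates with respect to this frame the metric and the derivative along the rotation no
  longer contain \<open>v\<close>, so the geometry of the surface reduces to algebra in \<open>f\<close>, \<open>g\<close> and their
  derivatives.
\<close>

definition rotating_frame ::
  "real \<Rightarrow> real \<Rightarrow> real \<Rightarrow> real \<Rightarrow> real \<Rightarrow> real \<Rightarrow> real \<Rightarrow> real^4" where
  "rotating_frame \<alpha> \<beta> v a b c d =
     vector [a * cos (\<alpha> * v) - b * sin (\<alpha> * v), a * sin (\<alpha> * v) + b * cos (\<alpha> * v),
             c * cos (\<beta> * v) - d * sin (\<beta> * v), c * sin (\<beta> * v) + d * cos (\<beta> * v)]"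

lemma metric42_rotating_frame:
  "metric42 (rotating_frame \<alpha> \<beta> v a b c d) (rotating_frame \<alpha> \<beta> v a' b' c' d') =
     a * a' + b * b' - c * c' - d * d'"
  unfolding metric42_def rotating_frame_def vector_4
  using sin_cos_squared_add[of "\<alpha> * v"] sin_cos_squared_add[of "\<beta> * v"] by algebra

lemma rotating_frame_add:
  "rotating_frame \<alpha> \<beta> v a b c d + rotating_frame \<alpha> \<beta> v a' b' c' d' =
     rotating_frame \<alpha> \<beta> v (a + a') (b + b') (c + c') (d + d')"
  by (simp add: rotating_frame_def vec_eq_iff forall_4 vector_4 algebra_simps)

lemma rotating_frame_scale:
  "k *\<^sub>R rotating_frame \<alpha> \<beta> v a b c d = rotating_frame \<alpha> \<beta> v (k * a) (k * b) (k * c) (k * d)"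
  by (simp add: rotating_frame_def vec_eq_iff forall_4 vector_4 algebra_simps)

lemma general_rotational_elliptic_eq_rotating_frame:
  "general_rotational_elliptic \<alpha> \<beta> f g u v = rotating_frame \<alpha> \<beta> v (f u) 0 (g u) 0"
  by (simp add: general_rotational_elliptic_def rotating_frame_def)

lemma rotating_frame_eq_0_iff:
  "rotating_frame \<alpha> \<beta> v a b c d = 0 \<longleftrightarrow> a = 0 \<and> b = 0 \<and> c = 0 \<and> d = 0"
proof
  assume z: "rotating_frame \<alpha> \<beta> v a b c d = 0"
  have "metric42 (rotating_frame \<alpha> \<beta> v a b c d) w = 0" for w
    unfolding z by (simp add: metric42_def)
  from this[of "rotating_frame \<alpha> \<beta> v a b (-c) (-d)"]
  have "a * a + b * b + c * c + d * d = 0"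
    by (simp add: metric42_rotating_frame)
  then show "a = 0 \<and> b = 0 \<and> c = 0 \<and> d = 0"
    by (smt (verit) mult_eq_0_iff zero_le_square)
qed (simp add: rotating_frame_def vec_eq_iff forall_4 vector_4)

text \<open>The coordinates are found by turning both coordinate planes back.\<close>

lemma rotating_frame_surj: "\<exists>a b c d. w = rotating_frame \<alpha> \<beta> v a b c d"
proof -
  have *: "(x * cos t + y * sin t) * cos t - (y * cos t - x * sin t) * sin t = x"
    "(x * cos t + y * sin t) * sin t + (y * cos t - x * sin t) * cos t = y" for x y t :: real
    using sin_cos_squared_add[of t] by algebra+
  have "w = rotating_frame \<alpha> \<beta> v
      (w $ 1 * cos (\<alpha> * v) + w $ 2 * sin (\<alpha> * v)) (w $ 2 * cos (\<alpha> * v) - w $ 1 * sin (\<alpha> * v))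
      (w $ 3 * cos (\<beta> * v) + w $ 4 * sin (\<beta> * v)) (w $ 4 * cos (\<beta> * v) - w $ 3 * sin (\<beta> * v))"
    by (simp add: rotating_frame_def vec_eq_iff forall_4 vector_4 *)
  then show ?thesis by blast
qed

lemma metric42_has_real_derivative:
  assumes "(p has_vector_derivative p') (at t within T)" "(q has_vector_derivative q') (at t within T)"
  shows "((\<lambda>t. metric42 (p t) (q t)) has_real_derivative metric42 p' (q t) + metric42 (p t) q')
    (at t within T)"
proof -
  have "((\<lambda>t. w t $ i) has_real_derivative w' $ i) (at t within T)"
    if "(w has_vector_derivative w') (at t within T)" for w :: "real \<Rightarrow> real^4" and w' i
    using bounded_linear.has_vector_derivative[OF bounded_linear_vec_nth that]
    by (simp add: has_real_derivative_iff_has_vector_derivative)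
  note comp = this[OF assms(1)] this[OF assms(2)]
  show ?thesis
    unfolding metric42_def
    by (rule derivative_eq_intros comp refl | simp)+
qed

section \<open>Derivatives and smoothness\<close>

lemma constant_on_imp_real_derivative_eq_0:
  assumes "u \<in> T" "at u within T \<noteq> bot" "\<And>t. t \<in> T \<Longrightarrow> h t = k"
    and "(h has_real_derivative d) (at u within T)"
  shows "d = 0"
proof -
  have "(h has_vector_derivative 0) (at u within T)"
    using assms(3)
    by (intro has_vector_derivative_transform[OF assms(1) _ has_vector_derivative_const])
  then show ?thesis
    using vector_derivative_within[OF assms(2)] assms(4)
    by (metis has_real_derivative_iff_has_vector_derivative)
qed

lemma rotating_frame_has_vector_derivative_coefficients:
  assumes "(a has_real_derivative a') (at u within J)" "(c has_real_derivative c') (at u within J)"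
  shows "((\<lambda>s. rotating_frame \<alpha> \<beta> v (a s) 0 (c s) 0) has_vector_derivative
           rotating_frame \<alpha> \<beta> v a' 0 c' 0) (at u within J)"
  unfolding rotating_frame_def vector_4_eq_axis_sum
  by (rule derivative_eq_intros refl assms | simp)+

lemma rotating_frame_has_vector_derivative_angle:
  "((\<lambda>t. rotating_frame \<alpha> \<beta> t a b c d) has_vector_derivative
      rotating_frame \<alpha> \<beta> v (- \<alpha> * b) (\<alpha> * a) (- \<beta> * d) (\<beta> * c)) (at v within V)"
  unfolding rotating_frame_def vector_4_eq_axis_sum
  by (rule derivative_eq_intros refl | simp add: algebra_simps)+

text \<open>
  The mixed partial derivatives can be given in closed form, because differentiating \<open>j\<close> times in
  \<open>v\<close> multiplies by the \<open>j\<close>-th power of the frequency and advances the phase by \<open>j \<pi> / 2\<close>.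
\<close>

lemma smooth_field_general_rotational_elliptic:
  assumes "smooth_on_interval J f" "smooth_on_interval J g"
  shows "smooth_field J V (general_rotational_elliptic \<alpha> \<beta> f g)"
proof -
  obtain A where A: "\<And>u. u \<in> J \<Longrightarrow> A 0 u = f u"
    and A': "\<And>n u. u \<in> J \<Longrightarrow> (A n has_real_derivative A (Suc n) u) (at u within J)"
    using assms(1) unfolding smooth_on_interval_def by metis
  obtain B where B: "\<And>u. u \<in> J \<Longrightarrow> B 0 u = g u"
    and B': "\<And>n u. u \<in> J \<Longrightarrow> (B n has_real_derivative B (Suc n) u) (at u within J)"
    using assms(2) unfolding smooth_on_interval_def by metis
  have contA: "continuous_on J (A n)" and contB: "continuous_on J (B n)" for n
    using DERIV_continuous_on A' B' by blast+
  define q where "q = (\<lambda>j. real j * pi / 2)"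
  have q: "cos (x + q (Suc j)) = - sin (x + q j)" "sin (x + q (Suc j)) = cos (x + q j)" for x j
  proof -
    have "x + q (Suc j) = (x + q j) + pi / 2"
      by (simp add: q_def field_simps)
    then show "cos (x + q (Suc j)) = - sin (x + q j)" "sin (x + q (Suc j)) = cos (x + q j)"
      by (simp_all only: cos_add sin_add) simp_all
  qed
  define F where "F = (\<lambda>i j u v. vector
     [A i u * (\<alpha>^j * cos (\<alpha> * v + q j)), A i u * (\<alpha>^j * sin (\<alpha> * v + q j)),
      B i u * (\<beta>^j * cos (\<beta> * v + q j)), B i u * (\<beta>^j * sin (\<beta> * v + q j))] :: real^4)"
  have "\<forall>u\<in>J. \<forall>v\<in>V. F 0 0 u v = general_rotational_elliptic \<alpha> \<beta> f g u v"
    by (simp add: F_def q_def A B general_rotational_elliptic_def)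
  moreover have "continuous_on (J \<times> V) (\<lambda>(u, v). F i j u v)" for i j
    unfolding F_def vector_4_eq_axis_sum case_prod_unfold
    by (intro continuous_intros continuous_on_compose2[OF contA] continuous_on_compose2[OF contB]) auto
  moreover have "((\<lambda>s. F i j s v) has_vector_derivative F (Suc i) j u v) (at u within J)"
    if "u \<in> J" for i j u v
    unfolding F_def vector_4_eq_axis_sum
    by (rule derivative_eq_intros refl A'[OF that] B'[OF that] | simp)+
  moreover have "((\<lambda>t. F i j u t) has_vector_derivative F i (Suc j) u v) (at v within V)"
    for i j u v
    unfolding F_def vector_4_eq_axis_sum q
    by (rule derivative_eq_intros refl | simp add: algebra_simps)+
  ultimately show ?thesis
    unfolding smooth_field_def by (intro exI[of _ F]) auto
qed

lemma smooth_field_has_partial_derivative: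
  assumes "smooth_field J V w" "u \<in> J" "v \<in> V"
  shows "\<exists>w'. ((\<lambda>t. w u t) has_vector_derivative w') (at v within V)"
proof -
  obtain F where F0: "\<forall>u\<in>J. \<forall>v\<in>V. F 0 0 u v = w u v"
    and F: "\<forall>i j. continuous_on (J \<times> V) (\<lambda>(u, v). F i j u v) \<and>
      (\<forall>u\<in>J. \<forall>v\<in>V.
        ((\<lambda>s. F i j s v) has_vector_derivative F (Suc i) j u v) (at u within J) \<and>
        ((\<lambda>t. F i j u t) has_vector_derivative F i (Suc j) u v) (at v within V))"
    using assms(1) unfolding smooth_field_def by blast
  have "((\<lambda>t. F 0 0 u t) has_vector_derivative F 0 (Suc 0) u v) (at v within V)"
    using F assms(2,3) by blast
  then have "((\<lambda>t. w u t) has_vector_derivative F 0 (Suc 0) u v) (at v within V)"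
    by (rule has_vector_derivative_transform[OF assms(3), rotated]) (simp add: F0 assms(2))
  then show ?thesis by blast
qed

lemma smooth_on_interval_divide:
  assumes "smooth_on_interval J f"
  shows "smooth_on_interval J (\<lambda>u. f u / c)"
proof -
  obtain F where "\<And>u. u \<in> J \<Longrightarrow> F 0 u = f u"
    "\<And>n u. u \<in> J \<Longrightarrow> (F n has_real_derivative F (Suc n) u) (at u within J)"
    using assms unfolding smooth_on_interval_def by metis
  then show ?thesis
    unfolding smooth_on_interval_def
    by (intro exI[of _ "\<lambda>n u. F n u / c"]) (auto intro: DERIV_cdivide)
qed

text \<open>
  The witnesses of smoothness agree with the function on \<open>J\<close> only, which suffices because the
  derivatives are taken within \<open>J\<close>.
\<close>

lemma smooth_on_interval_derivatives:
  assumes "smooth_on_interval J f"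
  obtains f' f'' where "\<And>u. u \<in> J \<Longrightarrow> (f has_real_derivative f' u) (at u within J)"
    "\<And>u. u \<in> J \<Longrightarrow> (f' has_real_derivative f'' u) (at u within J)"
proof -
  obtain F where F: "\<And>u. u \<in> J \<Longrightarrow> F 0 u = f u"
    "\<And>n u. u \<in> J \<Longrightarrow> (F n has_real_derivative F (Suc n) u) (at u within J)"
    using assms unfolding smooth_on_interval_def by metis
  have "(f has_real_derivative F 1 u) (at u within J)" if "u \<in> J" for u
    using has_vector_derivative_transform[OF that, of f "F 0"] F that
    by (simp add: has_real_derivative_iff_has_vector_derivative)
  then show thesis using that[of "F 1" "F 2"] F(2)[of _ 1] by (simp add: numeral_2_eq_2)
qed

section \<open>The geometry of the surface\<close>

text \<open>
  Two candidates for the normal part differ by a tangent vector orthogonal to both tangent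
  vectors. Its coefficients solve the homogeneous system of the Gram matrix, which is invertible.
\<close>

lemma normal_part_eqI:
  assumes nd: "ffE J z u v * ffG V z u v - (ffF J V z u v)\<^sup>2 \<noteq> 0"
    and n: "is_normal J V z u v n" and t: "w - n \<in> span {du J z u v, dv V z u v}"
  shows "normal_part J V z u v w = n"
  unfolding normal_part_def
proof (rule the_equality)
  show "is_normal J V z u v n \<and> w - n \<in> span {du J z u v, dv V z u v}"
    using n t by blast
next
  fix m assume m: "is_normal J V z u v m \<and> w - m \<in> span {du J z u v, dv V z u v}"
  let ?x = "du J z u v" and ?y = "dv V z u v"
  have "(w - m) - (w - n) \<in> span {?x, ?y}"
    using m t span_diff by blast
  then obtain a b where ab: "n - m = a *\<^sub>R ?x + b *\<^sub>R ?y"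
    by (auto simp: span_insert span_singleton algebra_simps)
  have lin: "metric42 (p - q) r = metric42 p r - metric42 q r"
    "metric42 (p + q) r = metric42 p r + metric42 q r"
    "metric42 (k *\<^sub>R p) r = k * metric42 p r" for p q r k
    by (simp_all add: metric42_def algebra_simps)
  have comm: "metric42 p r = metric42 r p" for p r
    by (simp add: metric42_def algebra_simps)
  have "metric42 (n - m) ?x = 0" "metric42 (n - m) ?y = 0"
    using m n by (simp_all add: lin is_normal_def)
  then have 1: "a * ffE J z u v + b * ffF J V z u v = 0"
    and 2: "a * ffF J V z u v + b * ffG V z u v = 0"
    unfolding ab lin ffE_def ffF_def ffG_def by (simp_all add: comm)
  have "a * (ffE J z u v * ffG V z u v - (ffF J V z u v)\<^sup>2) = 0"
    "b * (ffE J z u v * ffG V z u v - (ffF J V z u v)\<^sup>2) = 0"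
    using 1 2 by algebra+
  with nd ab show "m = n" by simp
qed

text \<open>
  The derivatives of the meridian are parameters of the locale rather than derivative operators
  applied to \<open>f\<close> and \<open>g\<close>, so that the computations refer to the values on \<open>J\<close> alone. The two
  conditions on limit points make the derivatives within the parameter domains unique.
\<close>

locale elliptic_rotational_surface =
  fixes J V :: "real set" and \<alpha> \<beta> :: real and f g f' g' f'' g'' :: "real \<Rightarrow> real"
  assumes J_perfect: "u \<in> J \<Longrightarrow> at u within J \<noteq> bot"
    and V_perfect: "v \<in> V \<Longrightarrow> at v within V \<noteq> bot"
    and f': "u \<in> J \<Longrightarrow> (f has_real_derivative f' u) (at u within J)"
    and g': "u \<in> J \<Longrightarrow> (g has_real_derivative g' u) (at u within J)"
    and f'': "u \<in> J \<Longrightarrow> (f' has_real_derivative f'' u) (at u within J)"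
    and g'': "u \<in> J \<Longrightarrow> (g' has_real_derivative g'' u) (at u within J)"
    and E_pos: "u \<in> J \<Longrightarrow> (f' u)\<^sup>2 - (g' u)\<^sup>2 > 0"
    and G_neg: "u \<in> J \<Longrightarrow> \<alpha>\<^sup>2 * (f u)\<^sup>2 - \<beta>\<^sup>2 * (g u)\<^sup>2 < 0"
    and frequencies_pos: "\<alpha> > 0" "\<beta> > 0"
begin

abbreviation z where "z \<equiv> general_rotational_elliptic \<alpha> \<beta> f g"

abbreviation R where "R \<equiv> rotating_frame \<alpha> \<beta>"

lemma du_eqI:
  assumes "u \<in> J" "((\<lambda>s. w s v) has_vector_derivative w') (at u within J)"
  shows "du J w u v = w'"
  using vector_derivative_within[OF J_perfect[OF assms(1)] assms(2)] by (simp add: du_def)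

lemma dv_eqI:
  assumes "v \<in> V" "((\<lambda>t. w u t) has_vector_derivative w') (at v within V)"
  shows "dv V w u v = w'"
  using vector_derivative_within[OF V_perfect[OF assms(1)] assms(2)] by (simp add: dv_def)

lemma du_z: "u \<in> J \<Longrightarrow> du J z u v = R v (f' u) 0 (g' u) 0"
  by (rule du_eqI, assumption, unfold general_rotational_elliptic_eq_rotating_frame)
     (intro rotating_frame_has_vector_derivative_coefficients f' g')

lemma dv_z: "v \<in> V \<Longrightarrow> dv V z u v = R v 0 (\<alpha> * f u) 0 (\<beta> * g u)"
  using rotating_frame_has_vector_derivative_angle[of \<alpha> \<beta> "f u" 0 "g u" 0 v V]
  by (intro dv_eqI) (simp_all add: general_rotational_elliptic_eq_rotating_frame)

lemma du_du_z:
  assumes "u \<in> J" shows "du J (du J z) u v = R v (f'' u) 0 (g'' u) 0"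
proof (rule du_eqI[OF assms])
  show "((\<lambda>s. du J z s v) has_vector_derivative R v (f'' u) 0 (g'' u) 0) (at u within J)"
    by (rule has_vector_derivative_transform[OF assms _
          rotating_frame_has_vector_derivative_coefficients[OF f'' g'']])
       (use assms in \<open>simp_all add: du_z\<close>)
qed

lemma dv_dv_z:
  assumes "v \<in> V" shows "dv V (dv V z) u v = R v (- \<alpha>\<^sup>2 * f u) 0 (- \<beta>\<^sup>2 * g u) 0"
proof (rule dv_eqI[OF assms])
  show "((\<lambda>t. dv V z u t) has_vector_derivative R v (- \<alpha>\<^sup>2 * f u) 0 (- \<beta>\<^sup>2 * g u) 0) (at v within V)"
    using has_vector_derivative_transform[OF assms _ rotating_frame_has_vector_derivative_angle,
        of "dv V z u" \<alpha> \<beta> 0 "\<alpha> * f u" 0 "\<beta> * g u"]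
    by (simp add: dv_z power2_eq_square mult.assoc)
qed

lemma first_fundamental_form:
  assumes "u \<in> J" "v \<in> V"
  shows "ffE J z u v = (f' u)\<^sup>2 - (g' u)\<^sup>2" "ffF J V z u v = 0"
    "ffG V z u v = \<alpha>\<^sup>2 * (f u)\<^sup>2 - \<beta>\<^sup>2 * (g u)\<^sup>2"
  using assms
  by (simp_all add: ffE_def ffF_def ffG_def du_z dv_z metric42_rotating_frame power2_eq_square
      algebra_simps)

lemma g_nonzero: "u \<in> J \<Longrightarrow> g u \<noteq> 0"
  using G_neg[of u] zero_le_power2[of "\<alpha> * f u"] unfolding power_mult_distrib by force

lemma nondegenerate:
  assumes "u \<in> J" "v \<in> V"
  shows "ffE J z u v * ffG V z u v - (ffF J V z u v)\<^sup>2 \<noteq> 0"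
  using E_pos[OF assms(1)] G_neg[OF assms(1)] by (simp add: first_fundamental_form[OF assms])

text \<open>
  The tangent vectors and \<open>n1\<close>, \<open>n2\<close> split into two Lorentz planes, \<open>(*, 0, *, 0)\<close> and
  \<open>(0, *, 0, *)\<close>, in each of which the normal vector is the tangent vector with its coordinates
  interchanged. The coefficients are the quotients \<open>\<langle>w, n1\<rangle> / \<langle>n1, n1\<rangle>\<close> and
  \<open>\<langle>w, n2\<rangle> / \<langle>n2, n2\<rangle>\<close>, with \<open>\<langle>n1, n1\<rangle> = -E\<close> and \<open>\<langle>n2, n2\<rangle> = -G\<close>.
\<close>

lemma normal_part_rotating_frame:
  assumes "u \<in> J" "v \<in> V"
  shows "normal_part J V z u v (R v a b c d) =
    ((c * f' u - a * g' u) / ((f' u)\<^sup>2 - (g' u)\<^sup>2)) *\<^sub>R R v (g' u) 0 (f' u) 0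
    + ((d * \<alpha> * f u - b * \<beta> * g u) / (\<alpha>\<^sup>2 * (f u)\<^sup>2 - \<beta>\<^sup>2 * (g u)\<^sup>2)) *\<^sub>R
        R v 0 (\<beta> * g u) 0 (\<alpha> * f u)"
    (is "_ = ?k *\<^sub>R ?m + ?l *\<^sub>R ?n")
proof (rule normal_part_eqI[OF nondegenerate[OF assms]])
  let ?E = "(f' u)\<^sup>2 - (g' u)\<^sup>2" and ?G = "\<alpha>\<^sup>2 * (f u)\<^sup>2 - \<beta>\<^sup>2 * (g u)\<^sup>2"
  have E: "?E \<noteq> 0" and G: "?G \<noteq> 0"
    using E_pos[OF assms(1)] G_neg[OF assms(1)] by simp_all
  show "is_normal J V z u v (?k *\<^sub>R ?m + ?l *\<^sub>R ?n)"
    using assms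
    by (simp add: is_normal_def du_z dv_z metric42_rotating_frame rotating_frame_scale
        rotating_frame_add)
  \<comment> \<open>The orthogonal decomposition of \<open>(a, c)\<close> along \<open>(x', x)\<close> and \<open>(x, x')\<close> in a Lorentz plane;
    it serves both planes.\<close>
  have split: "a = (c * x - a * x') / (x\<^sup>2 - x'\<^sup>2) * x' + (a * x - c * x') / (x\<^sup>2 - x'\<^sup>2) * x
      \<and> c = (c * x - a * x') / (x\<^sup>2 - x'\<^sup>2) * x + (a * x - c * x') / (x\<^sup>2 - x'\<^sup>2) * x'"
    if "x\<^sup>2 - x'\<^sup>2 \<noteq> 0" for a c x x' :: real
  proof -
    define e where "e = x\<^sup>2 - x'\<^sup>2"
    have "(c * x - a * x') * x' + (a * x - c * x') * x = a * e"
      "(c * x - a * x') * x + (a * x - c * x') * x' = c * e"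
      by (simp_all add: e_def algebra_simps power2_eq_square)
    then show ?thesis
      using that by (simp add: e_def[symmetric] add_divide_distrib[symmetric])
  qed
  have "R v a b c d = ?k *\<^sub>R ?m + ?l *\<^sub>R ?n +
      (((a * f' u - c * g' u) / ?E) *\<^sub>R du J z u v
      + ((b * (\<alpha> * f u) - d * (\<beta> * g u)) / ?G) *\<^sub>R dv V z u v)"
    using split[OF E, of a c] split[where x = "\<alpha> * f u" and x' = "\<beta> * g u" and a = b and c = d] G assms
    by (simp add: du_z dv_z rotating_frame_add rotating_frame_scale power_mult_distrib mult.assoc)
  then have "R v a b c d - (?k *\<^sub>R ?m + ?l *\<^sub>R ?n) =
      ((a * f' u - c * g' u) / ?E) *\<^sub>R du J z u v
      + ((b * (\<alpha> * f u) - d * (\<beta> * g u)) / ?G) *\<^sub>R dv V z u v"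
    by simp
  then show "R v a b c d - (?k *\<^sub>R ?m + ?l *\<^sub>R ?n) \<in> span {du J z u v, dv V z u v}"
    by (simp add: span_base span_scale span_add)
qed

lemma normal_part_eq_0_imp_orthogonal:
  assumes "u \<in> J" "v \<in> V" "normal_part J V z u v w = 0"
  shows "metric42 w (R v 0 (\<beta> * g u) 0 (\<alpha> * f u)) = 0"
proof -
  obtain a b c d where w: "w = R v a b c d"
    using rotating_frame_surj by blast
  have "d * \<alpha> * f u - b * \<beta> * g u = 0 \<or> \<beta> * g u = 0 \<and> \<alpha> * f u = 0"
    using assms(3) G_neg[OF assms(1)]
    unfolding w normal_part_rotating_frame[OF assms(1,2)]
    by (auto simp: rotating_frame_scale rotating_frame_add rotating_frame_eq_0_iff)
  then show ?thesis
    by (auto simp: w metric42_rotating_frame)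
qed

lemma normal_part_tangent:
  assumes "u \<in> J" "v \<in> V" "w \<in> span {du J z u v, dv V z u v}"
  shows "normal_part J V z u v w = 0"
  using assms(3)
  by (intro normal_part_eqI[OF nondegenerate[OF assms(1,2)]]) (simp_all add: is_normal_def metric42_def)

text \<open>
  Since the mixed coefficient of the first fundamental form vanishes, only \<open>z_uu\<close> and \<open>z_vv\<close>
  contribute, and both are orthogonal to \<open>n2\<close>. This is why \<open>H\<close> is a multiple of \<open>n1\<close>.
\<close>

lemma mean_curv_z:
  assumes "u \<in> J" "v \<in> V"
  shows "mean_curv J V z u v =
    (((g'' u * f' u - f'' u * g' u) / ((f' u)\<^sup>2 - (g' u)\<^sup>2)\<^sup>2
      + (\<alpha>\<^sup>2 * f u * g' u - \<beta>\<^sup>2 * g u * f' u) /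
        (((f' u)\<^sup>2 - (g' u)\<^sup>2) * (\<alpha>\<^sup>2 * (f u)\<^sup>2 - \<beta>\<^sup>2 * (g u)\<^sup>2))) / 2) *\<^sub>R R v (g' u) 0 (f' u) 0"
proof -
  define E G where "E = (f' u)\<^sup>2 - (g' u)\<^sup>2" "G = \<alpha>\<^sup>2 * (f u)\<^sup>2 - \<beta>\<^sup>2 * (g u)\<^sup>2"
  have nz: "E \<noteq> 0" "G \<noteq> 0"
    using E_pos[OF assms(1)] G_neg[OF assms(1)] by (simp_all add: E_G_def)
  define p q where "p = g'' u * f' u - f'' u * g' u" "q = \<alpha>\<^sup>2 * f u * g' u - \<beta>\<^sup>2 * g u * f' u"
  have uu: "sigma_uu J V z u v = (p / E) *\<^sub>R R v (g' u) 0 (f' u) 0"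
    using assms by (simp add: sigma_uu_def du_du_z normal_part_rotating_frame E_G_def p_q_def)
  have vv: "sigma_vv J V z u v = (q / E) *\<^sub>R R v (g' u) 0 (f' u) 0"
    using assms by (simp add: sigma_vv_def dv_dv_z normal_part_rotating_frame E_G_def p_q_def)
  have "mean_curv J V z u v = ((p / E\<^sup>2 + q / (E * G)) / 2) *\<^sub>R R v (g' u) 0 (f' u) 0"
    unfolding mean_curv_def uu vv first_fundamental_form[OF assms] E_G_def[symmetric]
    using nz by (simp add: scaleR_add_left[symmetric])
      (simp add: field_simps power2_eq_square)
  then show ?thesis
    by (simp add: E_G_def p_q_def)
qed

text \<open>
  The connection form of the normal bundle along the rotation, \<open>\<langle>(n1)_v, n2\<rangle>\<close>, is a multiple of
  \<open>g g' - f f'\<close> and must vanish where a multiple of \<open>n1\<close> is parallel. The equation says that the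
  position vector is orthogonal to the meridians, hence to the surface.
\<close>

lemma parallel_normalized_imp_position_normal:
  assumes par: "has_parallel_normalized_mean_curv J V z" and "u \<in> J" "v \<in> V"
  shows "f u * f' u = g u * g' u"
proof -
  let ?n2 = "\<lambda>t. R t 0 (\<beta> * g u) 0 (\<alpha> * f u)"
  have H0: "\<And>t. t \<in> V \<Longrightarrow> mean_curv J V z u t \<noteq> 0"
    using par \<open>u \<in> J\<close> unfolding has_parallel_normalized_mean_curv_def by blast
  obtain \<xi> where \<xi>: "parallel_normal J V z \<xi>"
    and H\<xi>: "\<And>t. t \<in> V \<Longrightarrow> \<exists>c>0. mean_curv J V z u t = c *\<^sub>R \<xi> u t"
    using par \<open>u \<in> J\<close> unfolding has_parallel_normalized_mean_curv_def by blast
  have along: "\<exists>k. \<xi> u t = k *\<^sub>R R t (g' u) 0 (f' u) 0 \<and> k \<noteq> 0" if t: "t \<in> V" for t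
  proof -
    obtain c where c: "c > 0" "mean_curv J V z u t = c *\<^sub>R \<xi> u t"
      using H\<xi>[OF t] by blast
    moreover obtain \<kappa> where k: "mean_curv J V z u t = \<kappa> *\<^sub>R R t (g' u) 0 (f' u) 0"
      using mean_curv_z[OF \<open>u \<in> J\<close> t] by blast
    ultimately have "c *\<^sub>R \<xi> u t = \<kappa> *\<^sub>R R t (g' u) 0 (f' u) 0"
      by simp
    then have "(1 / c) *\<^sub>R c *\<^sub>R \<xi> u t = (1 / c) *\<^sub>R \<kappa> *\<^sub>R R t (g' u) 0 (f' u) 0"
      by (rule arg_cong)
    then have "\<xi> u t = (\<kappa> / c) *\<^sub>R R t (g' u) 0 (f' u) 0"
      using c by simp
    moreover have "\<kappa> \<noteq> 0" using k H0[OF t] by auto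
    ultimately show ?thesis using \<open>c > 0\<close> by (intro exI[of _ "\<kappa> / c"]) auto
  qed
  obtain \<xi>' where \<xi>': "((\<lambda>t. \<xi> u t) has_vector_derivative \<xi>') (at v within V)"
    using \<xi> smooth_field_has_partial_derivative assms(2,3)
    unfolding parallel_normal_def normal_field_def by meson
  then have dv\<xi>: "dv V \<xi> u v = \<xi>'"
    by (rule dv_eqI[OF \<open>v \<in> V\<close>])
  \<comment> \<open>The derivative is moved from \<open>\<xi>\<close> to \<open>n2\<close>, which is explicit, by the product rule for
    \<open>\<langle>\<xi>, n2\<rangle> = 0\<close>.\<close>
  have "metric42 \<xi>' (?n2 v) = 0"
    using \<xi> normal_part_eq_0_imp_orthogonal[OF assms(2,3)] assms(2,3)
    unfolding parallel_normal_def dv\<xi>[symmetric] by blast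
  moreover have "metric42 \<xi>' (?n2 v) + metric42 (\<xi> u v) (R v (- \<alpha> * (\<beta> * g u)) 0 (- \<beta> * (\<alpha> * f u)) 0) = 0"
  proof -
    have "((\<lambda>t. metric42 (\<xi> u t) (?n2 t)) has_real_derivative
        metric42 \<xi>' (?n2 v) + metric42 (\<xi> u v) (R v (- \<alpha> * (\<beta> * g u)) 0 (- \<beta> * (\<alpha> * f u)) 0))
        (at v within V)"
      using metric42_has_real_derivative[OF \<xi>' rotating_frame_has_vector_derivative_angle,
          of \<alpha> \<beta> 0 "\<beta> * g u" 0 "\<alpha> * f u"]
      by simp
    then show ?thesis
    proof (rule constant_on_imp_real_derivative_eq_0[OF \<open>v \<in> V\<close> V_perfect[OF \<open>v \<in> V\<close>], rotated])
      show "metric42 (\<xi> u t) (?n2 t) = 0" if "t \<in> V" for t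
        using along[OF that] by (auto simp: rotating_frame_scale metric42_rotating_frame)
    qed
  qed
  ultimately have "metric42 (\<xi> u v) (R v (- \<alpha> * (\<beta> * g u)) 0 (- \<beta> * (\<alpha> * f u)) 0) = 0"
    by simp
  moreover obtain k where "\<xi> u v = k *\<^sub>R R v (g' u) 0 (f' u) 0" "k \<noteq> 0"
    using along[OF \<open>v \<in> V\<close>] by blast
  ultimately have "k * \<alpha> * \<beta> * (f u * f' u - g u * g' u) = 0"
    by (simp add: rotating_frame_scale metric42_rotating_frame algebra_simps)
  with \<open>k \<noteq> 0\<close> frequencies_pos show ?thesis by simp
qed

text \<open>
  In the hyperquadric \<open>\<langle>x, x\<rangle> = -C\<^sup>2\<close> the position vector is normal to the surface, and
  differentiating \<open>\<langle>z, z_u\<rangle> = \<langle>z, z_v\<rangle> = 0\<close> shows that the component of the second fundamental form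
  along \<open>z\<close> is the first fundamental form over \<open>C\<^sup>2\<close>. There is no other component in \<open>H\<close>, since
  \<open>n1\<close> is a multiple of \<open>z\<close>; hence \<open>H = z / C\<^sup>2\<close>.
\<close>

lemma hyperbola_imp_parallel_normalized:
  assumes C: "C > 0" "\<And>u. u \<in> J \<Longrightarrow> (g u)\<^sup>2 - (f u)\<^sup>2 = C\<^sup>2"
    and smooth: "smooth_on_interval J f" "smooth_on_interval J g"
  shows "has_parallel_normalized_mean_curv J V z"
proof -
  have d1: "f u * f' u = g u * g' u" if "u \<in> J" for u
  proof -
    have "((\<lambda>u. (g u)\<^sup>2 - (f u)\<^sup>2) has_real_derivative 2 * g u * g' u - 2 * f u * f' u) (at u within J)"
      by (rule derivative_eq_intros f'[OF that] g'[OF that] refl | simp)+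
    then have "2 * g u * g' u - 2 * f u * f' u = 0"
      using C(2) by (intro constant_on_imp_real_derivative_eq_0[OF that J_perfect[OF that]])
    then show ?thesis by simp
  qed
  have d2: "f' u * f' u + f u * f'' u = g' u * g' u + g u * g'' u" if "u \<in> J" for u
  proof -
    have "((\<lambda>u. f u * f' u - g u * g' u) has_real_derivative
        (f' u * f' u + f u * f'' u) - (g' u * g' u + g u * g'' u)) (at u within J)"
      by (rule derivative_eq_intros f'[OF that] g'[OF that] f''[OF that] g''[OF that] refl | simp)+
    then have "(f' u * f' u + f u * f'' u) - (g' u * g' u + g u * g'' u) = 0"
      by (rule constant_on_imp_real_derivative_eq_0[OF that J_perfect[OF that], rotated])
         (simp add: d1)
    then show ?thesis by simp
  qed
  have H: "mean_curv J V z u v = (1 / C\<^sup>2) *\<^sub>R z u v" if "u \<in> J" "v \<in> V" for u v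
  proof -
    note g0 = g_nonzero[OF \<open>u \<in> J\<close>]
    \<comment> \<open>The tangent of the hyperbola is \<open>(f', g') = h (g, f)\<close>, whence \<open>n1 = h z\<close>; both terms of the
      mean curvature turn out to be \<open>1 / (h C\<^sup>2)\<close>.\<close>
    define h where "h = f' u / g u"
    define G where "G = \<alpha>\<^sup>2 * (f u)\<^sup>2 - \<beta>\<^sup>2 * (g u)\<^sup>2"
    have fh: "f' u = h * g u" and gh: "g' u = h * f u"
      using g0 d1[OF \<open>u \<in> J\<close>] by (simp_all add: h_def field_simps)
    have E: "(f' u)\<^sup>2 - (g' u)\<^sup>2 = h\<^sup>2 * C\<^sup>2"
      using C(2)[OF \<open>u \<in> J\<close>] unfolding fh gh by algebra
    have h0: "h \<noteq> 0"
      using E_pos[OF \<open>u \<in> J\<close>] unfolding E by auto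
    have G0: "G \<noteq> 0"
      using G_neg[OF \<open>u \<in> J\<close>] by (simp add: G_def)
    have "g'' u * f' u - f'' u * g' u = h ^ 3 * C\<^sup>2"
      using d2[OF \<open>u \<in> J\<close>] C(2)[OF \<open>u \<in> J\<close>] unfolding fh gh by algebra
    moreover have "\<alpha>\<^sup>2 * f u * g' u - \<beta>\<^sup>2 * g u * f' u = h * G"
      unfolding fh gh G_def by algebra
    ultimately have "mean_curv J V z u v =
        ((h ^ 3 * C\<^sup>2 / (h\<^sup>2 * C\<^sup>2)\<^sup>2 + h * G / ((h\<^sup>2 * C\<^sup>2) * G)) / 2) *\<^sub>R R v (g' u) 0 (f' u) 0"
      unfolding mean_curv_z[OF that] E G_def by simp
    also have "(h ^ 3 * C\<^sup>2 / (h\<^sup>2 * C\<^sup>2)\<^sup>2 + h * G / ((h\<^sup>2 * C\<^sup>2) * G)) / 2 = 1 / (h * C\<^sup>2)"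
      using h0 G0 C(1) by (simp add: field_simps power2_eq_square power3_eq_cube)
    also have "(1 / (h * C\<^sup>2)) *\<^sub>R R v (g' u) 0 (f' u) 0 = (1 / C\<^sup>2) *\<^sub>R z u v"
      using h0 by (simp add: fh gh general_rotational_elliptic_eq_rotating_frame rotating_frame_scale)
    finally show ?thesis .
  qed
  define \<xi> where "\<xi> = general_rotational_elliptic \<alpha> \<beta> (\<lambda>u. f u / C) (\<lambda>u. g u / C)"
  have \<xi>_frame: "\<xi> u v = R v (f u / C) 0 (g u / C) 0" for u v
    by (simp add: \<xi>_def general_rotational_elliptic_eq_rotating_frame)
  have \<xi>_z: "\<xi> u v = (1 / C) *\<^sub>R z u v" for u v
    by (simp add: \<xi>_frame general_rotational_elliptic_eq_rotating_frame rotating_frame_scale)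
  have du\<xi>: "du J \<xi> u v = (1 / C) *\<^sub>R du J z u v" if "u \<in> J" for u v
  proof -
    have "du J \<xi> u v = R v (f' u / C) 0 (g' u / C) 0"
    proof (rule du_eqI[OF that])
      show "((\<lambda>s. \<xi> s v) has_vector_derivative R v (f' u / C) 0 (g' u / C) 0) (at u within J)"
        unfolding \<xi>_frame
        by (intro rotating_frame_has_vector_derivative_coefficients DERIV_cdivide f'[OF that] g'[OF that])
    qed
    then show ?thesis using that by (simp add: du_z rotating_frame_scale)
  qed
  have dv\<xi>: "dv V \<xi> u v = (1 / C) *\<^sub>R dv V z u v" if "v \<in> V" for u v
  proof -
    have "dv V \<xi> u v = R v (- \<alpha> * 0) (\<alpha> * (f u / C)) (- \<beta> * 0) (\<beta> * (g u / C))"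
    proof (rule dv_eqI[OF that])
      show "((\<lambda>t. \<xi> u t) has_vector_derivative
          R v (- \<alpha> * 0) (\<alpha> * (f u / C)) (- \<beta> * 0) (\<beta> * (g u / C))) (at v within V)"
        unfolding \<xi>_frame by (rule rotating_frame_has_vector_derivative_angle)
    qed
    then show ?thesis using that by (simp add: dv_z rotating_frame_scale)
  qed
  have "smooth_field J V \<xi>"
    unfolding \<xi>_def
    by (intro smooth_field_general_rotational_elliptic smooth_on_interval_divide smooth)
  moreover have "is_normal J V z u v (\<xi> u v)" if "u \<in> J" "v \<in> V" for u v
    using d1[OF \<open>u \<in> J\<close>] that
    by (simp add: is_normal_def \<xi>_frame du_z dv_z metric42_rotating_frame)
  moreover have "normal_part J V z u v (du J \<xi> u v) = 0 \<and> normal_part J V z u v (dv V \<xi> u v) = 0"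
    if "u \<in> J" "v \<in> V" for u v
    using that by (auto intro!: normal_part_tangent simp: du\<xi> dv\<xi> span_base span_scale)
  ultimately have "parallel_normal J V z \<xi>"
    by (simp add: parallel_normal_def normal_field_def)
  moreover have unit: "metric42 (\<xi> u v) (\<xi> u v) = -1" if "u \<in> J" for u v
  proof -
    have "metric42 (\<xi> u v) (\<xi> u v) = - (((g u)\<^sup>2 - (f u)\<^sup>2) / C\<^sup>2)"
      by (simp add: \<xi>_frame metric42_rotating_frame power2_eq_square diff_divide_distrib)
    then show ?thesis using C that by simp
  qed
  moreover have "mean_curv J V z u v = (1 / C) *\<^sub>R \<xi> u v" if "u \<in> J" "v \<in> V" for u v
    using H[OF that] by (simp add: \<xi>_z power2_eq_square)
  moreover have "\<xi> u v \<noteq> 0" if "u \<in> J" for u v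
    using unit[OF that, of v] by (auto simp: metric42_def)
  ultimately show ?thesis
    using C(1) unfolding has_parallel_normalized_mean_curv_def
    by (intro conjI exI[of _ \<xi>] ballI exI[of _ "1 / C"]) auto
qed

end

section \<open>The hyperbola and the characterization\<close>

lemma meridian_hyperbola_imp_equation:
  assumes "meridian_hyperbola J f g C" "u \<in> J"
  shows "(g u)\<^sup>2 - (f u)\<^sup>2 = C\<^sup>2"
proof -
  obtain \<phi> where "C\<^sup>2 \<le> (\<phi> u)\<^sup>2" "g u = \<phi> u"
    "f u = sqrt ((\<phi> u)\<^sup>2 - C\<^sup>2) \<or> f u = - sqrt ((\<phi> u)\<^sup>2 - C\<^sup>2)"
    using assms unfolding meridian_hyperbola_def by blast
  then show ?thesis by auto
qed

text \<open>
  On the hyperbola \<open>\<bar>g\<bar> \<ge> \<bar>C\<bar>\<close>, so that \<open>f\<close> is recovered from \<open>g\<close> up to sign and \<open>g\<close> itself serves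
  as the new parameter.
\<close>

lemma meridian_hyperbolaI:
  assumes "smooth_on_interval J g"
    and "\<And>u. u \<in> J \<Longrightarrow> f u \<noteq> 0 \<Longrightarrow> vector_derivative g (at u within J) \<noteq> 0"
    and "\<And>u. u \<in> J \<Longrightarrow> (g u)\<^sup>2 - (f u)\<^sup>2 = C\<^sup>2"
  shows "meridian_hyperbola J f g C"
  unfolding meridian_hyperbola_def
proof (intro exI[of _ g] conjI ballI impI)
  fix u assume "u \<in> J"
  then have f: "(f u)\<^sup>2 = (g u)\<^sup>2 - C\<^sup>2" using assms(3)[of u] by simp
  then show "C\<^sup>2 \<le> (g u)\<^sup>2" by (metis diff_ge_0_iff_ge zero_le_power2)
  show "f u = sqrt ((g u)\<^sup>2 - C\<^sup>2) \<or> f u = - sqrt ((g u)\<^sup>2 - C\<^sup>2)"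
    unfolding f[symmetric] by (auto simp: abs_if)
qed (use assms in auto)

theorem theorem5p1:
  fixes J :: "real set" and f g :: "real \<Rightarrow> real" and \<alpha> \<beta> :: real
  assumes "is_interval J" and "interior J \<noteq> {}"
    and "\<alpha> > 0" and "\<beta> > 0"
    and "smooth_on_interval J f" and "smooth_on_interval J g"
    and "\<And>u. u \<in> J \<Longrightarrow> \<alpha>\<^sup>2 * (f u)\<^sup>2 - \<beta>\<^sup>2 * (g u)\<^sup>2 < 0"
    and "\<And>u. u \<in> J \<Longrightarrow>
           (vector_derivative f (at u within J))\<^sup>2 - (vector_derivative g (at u within J))\<^sup>2 > 0"
  shows "has_parallel_normalized_mean_curv J {0..<2*pi} (general_rotational_elliptic \<alpha> \<beta> f g)
         \<longleftrightarrow> (\<exists>C. C \<noteq> 0 \<and> meridian_hyperbola J f g C)"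
proof -
  have J: "at u within J \<noteq> bot" if "u \<in> J" for u
  proof -
    have "J \<noteq> {u}" using assms(2) by auto
    then show ?thesis
      using connected_imp_perfect[of J u] is_interval_connected[OF assms(1)] that
      by (auto simp: trivial_limit_within)
  qed
  have V: "at v within {0..<2*pi} \<noteq> bot" if "v \<in> {0..<2*pi}" for v :: real
  proof -
    have "pi \<in> {0..<2*pi}" "0 \<in> {0..<2*pi}" by simp_all
    then have "{0..<2*pi} \<noteq> {v}" using pi_neq_zero by (metis singletonD)
    then show ?thesis
      using connected_imp_perfect[of "{0..<2*pi}" v] that by (simp add: trivial_limit_within)
  qed
  obtain f' f'' where f': "\<And>u. u \<in> J \<Longrightarrow> (f has_real_derivative f' u) (at u within J)"
    "\<And>u. u \<in> J \<Longrightarrow> (f' has_real_derivative f'' u) (at u within J)"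
    using smooth_on_interval_derivatives[OF assms(5)] by blast
  obtain g' g'' where g': "\<And>u. u \<in> J \<Longrightarrow> (g has_real_derivative g' u) (at u within J)"
    "\<And>u. u \<in> J \<Longrightarrow> (g' has_real_derivative g'' u) (at u within J)"
    using smooth_on_interval_derivatives[OF assms(6)] by blast
  have vd: "vector_derivative f (at u within J) = f' u" "vector_derivative g (at u within J) = g' u"
    if "u \<in> J" for u
    using f'(1) g'(1) vector_derivative_within[OF J[OF that]] that
    by (metis has_real_derivative_iff_has_vector_derivative)+
  interpret elliptic_rotational_surface J "{0..<2*pi}" \<alpha> \<beta> f g f' g' f'' g''
    by unfold_locales (use J V f' g' assms(3,4,7,8) vd in auto)
  show ?thesis
  proof
    assume par: "has_parallel_normalized_mean_curv J {0..<2*pi} z"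
    have d: "f u * f' u = g u * g' u" if "u \<in> J" for u
      using parallel_normalized_imp_position_normal[OF par that, of 0] by simp
    have "((\<lambda>u. (g u)\<^sup>2 - (f u)\<^sup>2) has_real_derivative 0) (at u within J)" if "u \<in> J" for u
      by (rule derivative_eq_intros f'(1)[OF that] g'(1)[OF that] refl | use d[OF that] in \<open>simp add: algebra_simps\<close>)+
    then obtain K where K: "\<And>u. u \<in> J \<Longrightarrow> (g u)\<^sup>2 - (f u)\<^sup>2 = K"
      using has_field_derivative_zero_constant[of J "\<lambda>u. (g u)\<^sup>2 - (f u)\<^sup>2"]
        is_interval_convex[OF assms(1)] by blast
    obtain u where u: "u \<in> J" using assms(2) interior_subset by blast
    \<comment> \<open>The meridian is spacelike, so its position vector, being orthogonal to it in the Lorentz plane,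
      is timelike; this excludes the conjugate hyperbola and its asymptotes.\<close>
    have "(f u)\<^sup>2 < (g u)\<^sup>2"
    proof (rule ccontr)
      assume "\<not> ?thesis"
      then have le: "(g u)\<^sup>2 \<le> (f u)\<^sup>2" by simp
      have "(g u)\<^sup>2 * (g' u)\<^sup>2 < (g u)\<^sup>2 * (f' u)\<^sup>2"
        using E_pos[OF u] g_nonzero[OF u] by simp
      also have "\<dots> \<le> (f u)\<^sup>2 * (f' u)\<^sup>2"
        using le by (simp add: mult_right_mono)
      also have "\<dots> = (g u)\<^sup>2 * (g' u)\<^sup>2"
        using d[OF u] by (metis power_mult_distrib)
      finally show False by simp
    qed
    then have "K > 0" using K[OF u] by simp
    have "meridian_hyperbola J f g (sqrt K)"
    proof (rule meridian_hyperbolaI[OF assms(6)])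
      show "vector_derivative g (at u within J) \<noteq> 0" if "u \<in> J" "f u \<noteq> 0" for u
        using d[OF that(1)] that E_pos[OF that(1)] by (auto simp: vd)
    qed (use K \<open>K > 0\<close> in simp)
    then show "\<exists>C. C \<noteq> 0 \<and> meridian_hyperbola J f g C"
      using \<open>K > 0\<close> by (intro exI[of _ "sqrt K"]) simp
  next
    assume "\<exists>C. C \<noteq> 0 \<and> meridian_hyperbola J f g C"
    then obtain C where C: "C \<noteq> 0" "meridian_hyperbola J f g C" by blast
    show "has_parallel_normalized_mean_curv J {0..<2*pi} z"
      by (rule hyperbola_imp_parallel_normalized[of "\<bar>C\<bar>"])
         (use C meridian_hyperbola_imp_equation assms(5,6) in auto)
  qed
qed

end
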